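(* Let $n\ge 1$ be an integer. (i) For every set $P\subset\mathbb{R}$ of $n$ points in general position, there exists an order of $P$ such that the corresponding ordered Nearest Neighbor Graph has maximum indegree at least $\lceil \log_2 n\rceil$. (ii) There exists a set $P\subset \mathbb{R}$ of $n$ points in general position such that for every order of $P$, the indegree of each point of $P$ in the corresponding ordered Nearest Neighbor Graph is at most $\lceil \log_2 n\rceil$.
   Context: Distances on $\mathbb{R}$ are $|x-y|$. A point set is in general position if no three of its points determine a (possibly degenerate) isosceles triangle, i.e., there are no three distinct points $x,y,z$ in the set such that the distance from $x$ to $y$ equals the distance from $x$ to $z$. An order of a finite set $P$ with $|P|=n$ is an enumeration $(p_1,\dots,p_n)$ of all its elements, each appearing exactly once. The ordered Nearest Neighbor Graph corresponding to this order is the directed graph on vertex set $P$ in which, for each $2\le i\le n$, there is exactly one edge going out of $p_i$, namely the edge $p_i\to p_j$ where $p_j$ is the (unique, by general position) point of $\{p_1,\dots,p_{i-1}\}$ closest to $p_i$; the point $p_1$ has no outgoing edge. The indegree of a point is the number of edges pointing to it, and the maximum indegree is the maximum of the indegrees over all points of $P$. *)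

theory Defs
  imports
    Complex_Main
    "HOL-Combinatorics.Multiset_Permutations"
    "Graph_Theory.Digraph"
begin

definition general_position :: "'a::metric_space set \<Rightarrow> bool" where
  "general_position P \<longleftrightarrow>
     \<not> (\<exists>x\<in>P. \<exists>y\<in>P. \<exists>z\<in>P. x \<noteq> y \<and> x \<noteq> z \<and> y \<noteq> z \<and> dist x y = dist x z)"

(* An order of P is a list in permutations_of_set P.  List positions start at 0, so the
   positions i with 1 <= i < length ps are those of the points other than the first one,
   and set (take i ps) consists of the points preceding ps ! i. *)

definition ordered_nng :: "'a::metric_space list \<Rightarrow> ('a, 'a \<times> 'a) pre_digraph" where
  "ordered_nng ps =
     \<lparr> verts = set ps,
       arcs = {(ps ! i, q) | i q. 1 \<le> i \<and> i < length ps \<and>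
                 is_arg_min (dist (ps ! i)) (\<lambda>r. r \<in> set (take i ps)) q},
       tail = fst,
       head = snd \<rparr>"

definition max_in_degree :: "('a, 'b) pre_digraph \<Rightarrow> nat" where
  "max_in_degree G = Max (in_degree G ` verts G)"

end

theory Submission
  imports Defs
begin

text \<open>
  Both halves rest on one notion: a set \<open>A\<close> is tight relative to \<open>B\<close> if every point of \<open>A\<close> is
  closer to all of \<open>A\<close> than to any point of \<open>B\<close>.

  Lower bound. Points that all choose \<open>p\<close> can be listed so that each of them is closer to \<open>p\<close> than
  to its predecessors in the list; conversely, inserting \<open>p\<close>, then such a list, then everything else,
  makes the whole list point to \<open>p\<close> (\<open>in_degree_of_approach\<close>). Cut the interval spanned by \<open>P\<close> at
  its midpoint. One half contains at least half of the points, and it is tight relative to the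
  opposite end point \<open>b\<close> of the interval (\<open>tight_half\<close>): general position excludes the equality
  case, in which both end points and the midpoint all belong to \<open>P\<close>. Hence a list found
  recursively in this half can be extended by putting \<open>b\<close> in front. Each halving gains one
  in-neighbour, and so \<open>2 ^ k < card P\<close> yields \<open>k + 1\<close> of them (\<open>long_approach\<close>).

  Upper bound. If \<open>q\<close> and \<open>q'\<close> both point to \<open>p\<close>, then the one inserted later is at least as close to
  \<open>p\<close> as to the other one. Suppose that \<open>p\<close> lies in \<open>A\<close> and that \<open>B\<close> is tight relative to \<open>A\<close>:
  then at most one point of \<open>B\<close> points to \<open>p\<close>. So gluing two mutually tight sets of the same size
  increases the bound on indegrees by at most one while it doubles the number of points
  (\<open>spread_bound_Un\<close>). The set of all integers below \<open>3 ^ k\<close> with ternary digits 0 and 1 is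
  obtained by \<open>k\<close> such gluings from a single point, and any \<open>n\<close> of its points serve as the
  required set, where \<open>k\<close> is least with \<open>n \<le> 2 ^ k\<close>.
\<close>

section \<open>In-neighbours in an ordered nearest neighbour graph\<close>

lemma in_arcs_ordered_nng:
  "in_arcs (ordered_nng ps) p =
     (\<lambda>q. (q, p)) ` {ps ! i | i. 1 \<le> i \<and> i < length ps \<and>
                                is_arg_min (dist (ps ! i)) (\<lambda>r. r \<in> set (take i ps)) p}"
  unfolding ordered_nng_def in_arcs_def by (force simp: image_iff)

lemma in_degree_ordered_nng:
  "in_degree (ordered_nng ps) p =
     card {ps ! i | i. 1 \<le> i \<and> i < length ps \<and>
                       is_arg_min (dist (ps ! i)) (\<lambda>r. r \<in> set (take i ps)) p}"
  unfolding in_degree_def in_arcs_ordered_nng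
  by (rule card_image) (auto simp: inj_on_def)

definition tight_against :: "'a::metric_space set \<Rightarrow> 'a set \<Rightarrow> bool" where
  "tight_against A B \<longleftrightarrow> (\<forall>x\<in>A. \<forall>y\<in>A. \<forall>z\<in>B. dist x y < dist x z)"

lemma general_position_subset:
  "general_position P \<Longrightarrow> Q \<subseteq> P \<Longrightarrow> general_position Q"
  unfolding general_position_def by blast

section \<open>Lower bound: recursive bisection\<close>

definition approaches :: "'a::metric_space \<Rightarrow> 'a list \<Rightarrow> bool" where
  "approaches p qs \<longleftrightarrow> sorted_wrt (\<lambda>q q'. dist q' p < dist q' q) qs"

lemma approaches_distinct: "approaches p qs \<Longrightarrow> distinct qs"
  unfolding approaches_def
  by (induction qs) (auto dest: order.strict_trans1[OF zero_le_dist])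

text \<open>
  Every point of the list sees \<open>p\<close> as its nearest predecessor when \<open>p\<close> comes first, followed by
  the list; the remaining points are inserted last, where they cannot interfere.
\<close>

lemma in_degree_of_approach:
  fixes P :: "'a::metric_space set"
  assumes "finite P" "p \<in> P" "set qs \<subseteq> P - {p}" "approaches p qs"
  shows "\<exists>ps\<in>permutations_of_set P. length qs \<le> in_degree (ordered_nng ps) p"
proof -
  obtain rest where rest: "set rest = P - insert p (set qs)" "distinct rest"
    using finite_distinct_list[of "P - insert p (set qs)"] assms(1) by auto
  define ps where "ps = p # qs @ rest"
  have dqs: "distinct qs" using assms(4) by (rule approaches_distinct)
  have perm: "ps \<in> permutations_of_set P"
    unfolding permutations_of_set_def ps_def using assms(2,3) rest dqs by auto
  let ?N = "{ps ! i | i. 1 \<le> i \<and> i < length ps \<and>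
                  is_arg_min (dist (ps ! i)) (\<lambda>r. r \<in> set (take i ps)) p}"
  have "set qs \<subseteq> ?N"
  proof
    fix q assume "q \<in> set qs"
    then obtain j where j: "j < length qs" "q = qs ! j" by (auto simp: in_set_conv_nth)
    have nth: "ps ! Suc j = q" using j by (simp add: ps_def nth_append)
    have tk: "set (take (Suc j) ps) = insert p (set (take j qs))"
      using j by (simp add: ps_def)
    have "dist q p < dist q r" if "r \<in> set (take j qs)" for r
    proof -
      obtain i where "i < j" "r = qs ! i"
        using \<open>r \<in> set (take j qs)\<close> j by (auto simp: in_set_conv_nth)
      then show ?thesis
        using assms(4) j unfolding approaches_def sorted_wrt_iff_nth_less by auto
    qed
    then have "is_arg_min (dist (ps ! Suc j)) (\<lambda>r. r \<in> set (take (Suc j) ps)) p"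
      unfolding is_arg_min_def nth tk by force
    moreover have "Suc j < length ps" using j by (simp add: ps_def)
    ultimately show "q \<in> ?N" using nth by force
  qed
  moreover have "finite ?N"
    by (rule finite_subset[of _ "set ps"]) auto
  ultimately have "card (set qs) \<le> card ?N" by (rule card_mono[rotated])
  then have "length qs \<le> in_degree (ordered_nng ps) p"
    unfolding in_degree_ordered_nng distinct_card[OF dqs] .
  then show ?thesis using perm by blast
qed

text \<open>
  The two closed halves of the spanned interval cover \<open>P\<close>, so the fuller one has more than
  \<open>2 ^ k\<close> points. For a point \<open>x\<close> of the lower half, the distances to the points of that half are
  at most half of the diameter and the distance to the maximum is at least that much. Both can be
  equalities only if \<open>x\<close> is the midpoint and the minimum is the other point, which gives an isosceles
  triangle.
\<close>

lemma tight_half: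
  fixes P :: "real set"
  assumes "finite P" "general_position P" "2 ^ Suc k < card P"
  shows "\<exists>b\<in>P. \<exists>A\<subseteq>P - {b}. 2 ^ k < card A \<and> tight_against A {b}"
proof -
  define a b where "a = Min P" and "b = Max P"
  have "P \<noteq> {}" using assms(3) by auto
  then have ab: "a \<in> P" "b \<in> P" and bounds: "\<And>x. x \<in> P \<Longrightarrow> a \<le> x \<and> x \<le> b"
    using assms(1) by (auto simp: a_def b_def)
  have "a \<noteq> b"
  proof
    assume "a = b"
    then have "P \<subseteq> {a}" using bounds by force
    then have "card P \<le> 1" using card_mono[of "{a}" P] by simp
    then show False using assms(3) one_le_power[of "2::nat" "Suc k"] by linarith
  qed
  then have "a < b" using bounds[OF ab(1)] by simp
  define L U where "L = {x\<in>P. 2 * x \<le> a + b}" and "U = {x\<in>P. a + b \<le> 2 * x}"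
  have sub: "L \<subseteq> P - {b}" "U \<subseteq> P - {a}" using \<open>a < b\<close> by (auto simp: L_def U_def)
  have not_mid: "2 * x \<noteq> a + b" if "x \<in> P" for x
  proof
    assume mid: "2 * x = a + b"
    then have "dist x a = dist x b" by (simp add: dist_real_def)
    then show False using assms(2) that ab \<open>a < b\<close> mid unfolding general_position_def by force
  qed
  have tightL: "tight_against L {b}"
    unfolding tight_against_def
  proof (intro ballI)
    fix x y z assume "x \<in> L" "y \<in> L" "z \<in> {b}"
    then show "dist x y < dist x z"
      using bounds[of x] bounds[of y] not_mid[of x]
      unfolding L_def dist_real_def by auto
  qed
  have tightU: "tight_against U {a}"
    unfolding tight_against_def
  proof (intro ballI)
    fix x y z assume "x \<in> U" "y \<in> U" "z \<in> {a}"
    then show "dist x y < dist x z"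
      using bounds[of x] bounds[of y] not_mid[of x]
      unfolding U_def dist_real_def by auto
  qed
  have "P = L \<union> U" by (auto simp: L_def U_def)
  then have "card P \<le> card L + card U" using card_Un_le by metis
  then have "2 ^ k < card L \<or> 2 ^ k < card U" using assms(3) by auto
  then show ?thesis using sub tightL tightU ab by blast
qed

lemma long_approach:
  fixes P :: "real set"
  assumes "finite P" "general_position P" "2 ^ k < card P"
  shows "\<exists>p\<in>P. \<exists>qs. set qs \<subseteq> P - {p} \<and> approaches p qs \<and> length qs = Suc k"
  using assms
proof (induction k arbitrary: P)
  case 0
  then have "2 \<le> card P" by simp
  then obtain p q where "p \<in> P" "q \<in> P" "p \<noteq> q"
    using card_2_iff' obtain_subset_with_card_n[of 2 P] by (metis subsetD)
  then have "set [q] \<subseteq> P - {p} \<and> approaches p [q] \<and> length [q] = Suc 0"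
    by (auto simp: approaches_def)
  then show ?case using \<open>p \<in> P\<close> by blast
next
  case (Suc k)
  obtain b A where b: "b \<in> P" and A: "A \<subseteq> P - {b}" "2 ^ k < card A" and tight: "tight_against A {b}"
    using tight_half[OF Suc.prems] by blast
  have "finite A" "general_position A"
    using A(1) Suc.prems by (auto intro: finite_subset elim: general_position_subset)
  from Suc.IH[OF this A(2)] obtain p qs where
    p: "p \<in> A" and qs: "set qs \<subseteq> A - {p}" "approaches p qs" "length qs = Suc k"
    by blast
  have "approaches p (b # qs)"
    using p qs tight unfolding approaches_def tight_against_def by auto
  moreover have "set (b # qs) \<subseteq> P - {p}" using A(1) b p qs(1) by auto
  moreover have "length (b # qs) = Suc (Suc k)" using qs(3) by simp
  ultimately show ?case using A(1) p by blast
qed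

section \<open>Upper bound: gluing mutually tight sets\<close>

text \<open>
  The order-free shadow of being a set of in-neighbours of \<open>p\<close>: which of two in-neighbours came later
  is unknown, hence the minimum.
\<close>

definition spread_around :: "'a::metric_space \<Rightarrow> 'a set \<Rightarrow> bool" where
  "spread_around p I \<longleftrightarrow>
     (\<forall>q\<in>I. \<forall>q'\<in>I. q \<noteq> q' \<longrightarrow> min (dist q p) (dist q' p) \<le> dist q q')"

definition spread_bound :: "'a::metric_space set \<Rightarrow> nat \<Rightarrow> bool" where
  "spread_bound P k \<longleftrightarrow> (\<forall>p\<in>P. \<forall>I\<subseteq>P - {p}. spread_around p I \<longrightarrow> card I \<le> k)"

lemma spread_bound_subset: "spread_bound P k \<Longrightarrow> Q \<subseteq> P \<Longrightarrow> spread_bound Q k"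
  unfolding spread_bound_def by (meson Diff_mono order_refl subset_iff subset_trans)

lemma in_degree_le_spread_bound:
  assumes "ps \<in> permutations_of_set P" "p \<in> P" "spread_bound P k"
  shows "in_degree (ordered_nng ps) p \<le> k"
proof -
  have ps: "set ps = P" "distinct ps" using assms(1) by (auto simp: permutations_of_set_def)
  let ?arg = "\<lambda>i. is_arg_min (dist (ps ! i)) (\<lambda>r. r \<in> set (take i ps)) p"
  let ?N = "{ps ! i | i. 1 \<le> i \<and> i < length ps \<and> ?arg i}"
  have earlier: "ps ! i \<in> set (take j ps)" if "i < j" "j < length ps" for i j
    using that by (auto simp: in_set_conv_nth)
  have closer: "dist (ps ! j) p \<le> dist (ps ! j) (ps ! i)" if "i < j" "j < length ps" "?arg j" for i j
    using that(3) earlier[OF that(1,2)] unfolding is_arg_min_def by (auto simp: not_less)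
  have "ps ! i \<noteq> p" if "i < length ps" "?arg i" for i
    using that ps(2) unfolding is_arg_min_def
    by (auto simp: in_set_conv_nth nth_eq_iff_index_eq)
  then have "?N \<subseteq> P - {p}" using ps(1) by auto
  moreover have "spread_around p ?N"
    unfolding spread_around_def
  proof (intro ballI impI)
    fix q q' assume "q \<in> ?N" "q' \<in> ?N" "q \<noteq> q'"
    then obtain i j where ij: "q = ps ! i" "q' = ps ! j" "i < length ps" "j < length ps"
        "?arg i" "?arg j" "i \<noteq> j" by blast
    then consider "i < j" | "j < i" by linarith
    then show "min (dist q p) (dist q' p) \<le> dist q q'"
    proof cases
      case 1
      then show ?thesis using closer[of i j] ij by (simp add: dist_commute min.coboundedI2)
    next
      case 2
      then show ?thesis using closer[of j i] ij by (simp add: min.coboundedI1)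
    qed
  qed
  ultimately show ?thesis
    using assms(2,3) unfolding in_degree_ordered_nng spread_bound_def by blast
qed

text \<open>
  Two distinct points of \<open>B\<close> are closer to each other than either is to \<open>p \<in> A\<close>, so a spread set
  around \<open>p\<close> contains at most one point of \<open>B\<close>.
\<close>

lemma card_spread_around_Un:
  assumes "finite A" "finite B" "tight_against B A" "spread_bound A k"
    and "p \<in> A" "I \<subseteq> A \<union> B - {p}" "spread_around p I"
  shows "card I \<le> Suc k"
proof -
  have "card (I \<inter> A) \<le> k"
  proof -
    have "I \<inter> A \<subseteq> A - {p}" using assms(6) by blast
    moreover have "spread_around p (I \<inter> A)" using assms(7) by (auto simp: spread_around_def)
    ultimately show ?thesis using assms(4,5) unfolding spread_bound_def by blast
  qed
  moreover have "card (I \<inter> B) \<le> 1"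
  proof -
    have "q = q'" if "q \<in> I \<inter> B" "q' \<in> I \<inter> B" for q q'
    proof (rule ccontr)
      assume "q \<noteq> q'"
      then have "min (dist q p) (dist q' p) \<le> dist q q'"
        using that assms(7) by (auto simp: spread_around_def)
      moreover have "dist q q' < dist q p" "dist q' q < dist q' p"
        using that assms(3,5) by (auto simp: tight_against_def)
      ultimately show False by (simp add: dist_commute)
    qed
    then show ?thesis using assms(2) by (simp add: card_le_Suc0_iff_eq)
  qed
  moreover have "card I \<le> card (I \<inter> A) + card (I \<inter> B)"
  proof -
    have "I = I \<inter> A \<union> I \<inter> B" using assms(6) by blast
    then show ?thesis using card_Un_le by metis
  qed
  ultimately show ?thesis by linarith
qed

lemma spread_bound_Un:
  assumes "finite A" "finite B" "tight_against A B" "tight_against B A"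
    and "spread_bound A k" "spread_bound B k"
  shows "spread_bound (A \<union> B) (Suc k)"
  unfolding spread_bound_def
proof (intro ballI allI impI)
  fix p I assume p: "p \<in> A \<union> B" and I: "I \<subseteq> A \<union> B - {p}" "spread_around p I"
  show "card I \<le> Suc k"
  proof (cases "p \<in> A")
    case True
    then show ?thesis using card_spread_around_Un[of A B k p I] assms I by blast
  next
    case False
    then show ?thesis using card_spread_around_Un[of B A k p I] assms p I by (simp add: Un_commute)
  qed
qed

text \<open>
  An isosceles triangle meeting both parts would have one leg inside a part and the other leg
  across, or both legs across and a base inside a part. On the line the apex lies between the two
  other vertices, so the second case violates tightness as well: the base is longer than the legs.
\<close>

lemma general_position_Un:
  fixes A B :: "real set"
  assumes "tight_against A B" "tight_against B A" "general_position A" "general_position B"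
  shows "general_position (A \<union> B)"
  unfolding general_position_def
proof (rule notI, elim bexE conjE)
  fix x y z assume xyz: "x \<in> A \<union> B" "y \<in> A \<union> B" "z \<in> A \<union> B"
    and ne: "x \<noteq> y" "x \<noteq> z" "y \<noteq> z" and eq: "dist x y = dist x z"
  have base: "dist y x < dist y z" "dist z x < dist z y"
    using ne eq by (auto simp: dist_real_def abs_if split: if_splits)
  have inside: "\<not> (x \<in> C \<and> y \<in> C \<and> z \<in> C)" if "general_position C" for C
    using that ne eq unfolding general_position_def by blast
  have across: "\<not> (x \<in> C \<and> y \<in> C \<and> z \<in> D)" "\<not> (x \<in> C \<and> z \<in> C \<and> y \<in> D)"
    "\<not> (y \<in> C \<and> z \<in> C \<and> x \<in> D)" if "tight_against C D" for C D
    using that eq base unfolding tight_against_def by fastforce+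
  show False
    using xyz inside[OF assms(3)] inside[OF assms(4)] across[OF assms(1)] across[OF assms(2)]
    by blast
qed

text \<open>
  The numbers below \<open>3 ^ k\<close> whose ternary digits are 0 and 1. Base 3 makes the shift \<open>3 ^ k\<close> exceed
  twice the diameter \<open>(3 ^ k - 1) / 2\<close>, which is what makes the two copies mutually tight.
\<close>

fun zero_one_ternary :: "nat \<Rightarrow> real set" where
  "zero_one_ternary 0 = {0}"
| "zero_one_ternary (Suc k) = zero_one_ternary k \<union> (+) (3 ^ k) ` zero_one_ternary k"

lemma zero_one_ternary_bounds: "x \<in> zero_one_ternary k \<Longrightarrow> 0 \<le> x \<and> 2 * x < 3 ^ k"
proof (induction k arbitrary: x)
  case (Suc k)
  then show ?case by (fastforce intro: order.strict_trans)
qed simp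

lemma zero_one_ternary_copies_tight:
  "tight_against (zero_one_ternary k) ((+) (3 ^ k) ` zero_one_ternary k)"
  "tight_against ((+) (3 ^ k) ` zero_one_ternary k) (zero_one_ternary k)"
proof -
  have "dist x y < dist x (3 ^ k + z)" "dist (3 ^ k + x) (3 ^ k + y) < dist (3 ^ k + x) z"
    if "x \<in> zero_one_ternary k" "y \<in> zero_one_ternary k" "z \<in> zero_one_ternary k" for x y z
    using that[THEN zero_one_ternary_bounds] unfolding dist_real_def by linarith+
  then show "tight_against (zero_one_ternary k) ((+) (3 ^ k) ` zero_one_ternary k)"
    "tight_against ((+) (3 ^ k) ` zero_one_ternary k) (zero_one_ternary k)"
    unfolding tight_against_def by blast+
qed

lemma finite_zero_one_ternary: "finite (zero_one_ternary k)"
  by (induction k) auto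

lemma card_zero_one_ternary: "card (zero_one_ternary k) = 2 ^ k"
proof (induction k)
  case (Suc k)
  have "zero_one_ternary k \<inter> (+) (3 ^ k) ` zero_one_ternary k = {}"
  proof -
    have "x \<noteq> 3 ^ k + y" if "x \<in> zero_one_ternary k" "y \<in> zero_one_ternary k" for x y
      using that[THEN zero_one_ternary_bounds] by linarith
    then show ?thesis by blast
  qed
  then show ?case
    using Suc by (simp add: card_Un_disjoint finite_zero_one_ternary card_image)
qed simp

lemma general_position_translation:
  fixes A :: "real set"
  shows "general_position A \<Longrightarrow> general_position ((+) c ` A)"
  unfolding general_position_def by (simp add: dist_real_def)

lemma spread_bound_translation:
  fixes A :: "real set"
  assumes "spread_bound A k"
  shows "spread_bound ((+) c ` A) k"
  unfolding spread_bound_def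
proof (intro ballI allI impI)
  fix p I assume p: "p \<in> (+) c ` A" and I: "I \<subseteq> (+) c ` A - {p}" "spread_around p I"
  let ?J = "(\<lambda>x. x - c) ` I"
  have "p - c \<in> A" "?J \<subseteq> A - {p - c}" using p I(1) by auto
  moreover have "spread_around (p - c) ?J"
    using I(2) unfolding spread_around_def by (auto simp: dist_real_def)
  ultimately have "card ?J \<le> k" using assms unfolding spread_bound_def by blast
  then show "card I \<le> k" by (simp add: card_image inj_on_def)
qed

lemma zero_one_ternary_extremal:
  "general_position (zero_one_ternary k) \<and> spread_bound (zero_one_ternary k) k"
proof (induction k)
  case 0
  then show ?case by (auto simp: general_position_def spread_bound_def)
next
  case (Suc k)
  note tight = zero_one_ternary_copies_tight[of k]
  show ?case
    using Suc general_position_Un[OF tight] general_position_translation[of _ "3 ^ k"]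
      spread_bound_Un[OF _ _ tight] spread_bound_translation[of _ k "3 ^ k"]
      finite_zero_one_ternary[of k] by simp
qed

section \<open>The maximum indegree on the line\<close>

theorem theorem1:
  fixes n :: nat
  assumes "n \<ge> 1"
  shows "(\<forall>P :: real set. finite P \<and> card P = n \<and> general_position P \<longrightarrow>
            (\<exists>ps \<in> permutations_of_set P.
               int (max_in_degree (ordered_nng ps)) \<ge> \<lceil>log 2 (real n)\<rceil>))
       \<and> (\<exists>P :: real set. finite P \<and> card P = n \<and> general_position P \<and>
            (\<forall>ps \<in> permutations_of_set P. \<forall>p \<in> P.
               int (in_degree (ordered_nng ps) p) \<le> \<lceil>log 2 (real n)\<rceil>))"
proof -
  define m where "m = nat \<lceil>log 2 (real n)\<rceil>"
  have "0 \<le> log 2 (real n)" using assms by simp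
  then have m: "\<lceil>log 2 (real n)\<rceil> = int m" by (simp add: m_def)
  have le: "n \<le> 2 ^ m"
  proof -
    have "log 2 (real n) \<le> real m" using m by linarith
    then have "real n \<le> 2 powr real m" using assms by (subst (asm) log_le_iff) auto
    then have "real n \<le> real (2 ^ m)" by (simp add: powr_realpow)
    then show ?thesis by (simp only: of_nat_le_iff)
  qed
  have less: "2 ^ k < n" if "m = Suc k" for k
  proof -
    have "real k < log 2 (real n)" using m that by linarith
    then have "2 powr real k < real n" using assms by (subst (asm) less_log_iff) auto
    then have "real (2 ^ k) < real n" by (simp add: powr_realpow)
    then show ?thesis by (simp only: of_nat_less_iff)
  qed
  have "\<exists>ps\<in>permutations_of_set P. m \<le> max_in_degree (ordered_nng ps)"
    if P: "finite P" "card P = n" "general_position P" for P :: "real set"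
  proof -
    have "\<exists>p\<in>P. \<exists>qs. set qs \<subseteq> P - {p} \<and> approaches p qs \<and> length qs = m"
    proof (cases m)
      case 0
      have "P \<noteq> {}" using P(2) assms by auto
      then show ?thesis using 0 by (auto simp: approaches_def)
    next
      case (Suc k)
      then show ?thesis using long_approach[OF P(1,3)] less P(2) by blast
    qed
    then obtain p ps where ps: "p \<in> P" "ps \<in> permutations_of_set P"
        "m \<le> in_degree (ordered_nng ps) p"
      using in_degree_of_approach[OF P(1)] by metis
    moreover have "in_degree (ordered_nng ps) p \<le> max_in_degree (ordered_nng ps)"
      unfolding max_in_degree_def using ps(1,2) P(1)
      by (intro Max_ge) (auto simp: ordered_nng_def permutations_of_set_def)
    ultimately show ?thesis using le_trans by blast
  qed
  moreover have "\<exists>P :: real set. finite P \<and> card P = n \<and> general_position P \<and>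
            (\<forall>ps \<in> permutations_of_set P. \<forall>p \<in> P. in_degree (ordered_nng ps) p \<le> m)"
  proof -
    obtain P where P: "P \<subseteq> zero_one_ternary m" "card P = n" "finite P"
      using obtain_subset_with_card_n[of n "zero_one_ternary m"] le card_zero_one_ternary by metis
    have "general_position P" "spread_bound P m"
      using zero_one_ternary_extremal[of m] P(1) general_position_subset spread_bound_subset by blast+
    then show ?thesis using P in_degree_le_spread_bound by blast
  qed
  ultimately show ?thesis unfolding m by simp
qed

end
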